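(* Let $G$ be a connected graph on the vertex set $\{1,2,\dots,n\}$ and let $\lambda$ be the largest eigenvalue of the adjacency matrix of $G$. Let $\underline{y}=(y_1,\dots,y_n)$ be a positive eigenvector of unit (Euclidean) length corresponding to $\lambda$, and let $q_i=y_i^2$. Then for any (rooted) tree $T_m$ on $m$ vertices we have $$\hom(T_m,G)\geq \exp(H_{\lambda}(G))\,\lambda^{m-1},$$ where $$H_{\lambda}(G)=\sum_{i=1}^nq_i\log \frac{1}{q_i}$$ is the spectral entropy of the graph $G$.
   Context: Graphs are finite, undirected, without loops and multiple edges. $\hom(H,G)$ denotes the number of homomorphisms from $H$ to $G$, i.e. maps $f:V(H)\to V(G)$ such that images of adjacent vertices are adjacent. $\log$ is the natural logarithm. *)

theory Defs
  imports
    "HOL-Library.FuncSet"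
    "HOL-Analysis.L2_Norm"
    "Graph_Theory.Pair_Digraph"
    "Graph_Theory.Digraph_Component"
    "Jordan_Normal_Form.Spectral_Radius"
begin

text \<open>
  A finite simple undirected graph is a \<^locale>\<open>pair_graph\<close>: each undirected edge is
  represented by the two opposite arcs joining its ends.

  In this representation \<^const>\<open>Digraph_Component.tree\<close> is not the notion of an undirected tree,
  because going back and forth along one edge counts as a \<^const>\<open>pre_digraph.cycle\<close>. The cycles of
  the undirected graph are exactly those of length at least 3.
\<close>

definition is_tree :: "'a pair_pre_digraph \<Rightarrow> bool" where
  "is_tree T \<longleftrightarrow>
     pair_graph T \<and> Digraph_Component.connected (with_proj T) \<and>
     \<not> (\<exists>p. pre_digraph.cycle (with_proj T) p \<and> 3 \<le> length p)"

definition graph_homs :: "'a pair_pre_digraph \<Rightarrow> 'b pair_pre_digraph \<Rightarrow> ('a \<Rightarrow> 'b) set" where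
  "graph_homs H G =
     {f \<in> pverts H \<rightarrow>\<^sub>E pverts G. \<forall>u v. (u, v) \<in> parcs H \<longrightarrow> (f u, f v) \<in> parcs G}"

definition hom_count :: "'a pair_pre_digraph \<Rightarrow> 'b pair_pre_digraph \<Rightarrow> nat" where
  "hom_count H G = card (graph_homs H G)"

text \<open>
  Vertices are numbered from 1 to n, whereas the indices of the types mat and vec start at 0;
  hence the shift by \<^const>\<open>Suc\<close> in the next two definitions.
\<close>

definition adjacency_matrix :: "nat \<Rightarrow> nat pair_pre_digraph \<Rightarrow> real mat" where
  "adjacency_matrix n G = mat n n (\<lambda>(i, j). if (Suc i, Suc j) \<in> parcs G then 1 else 0)"

definition vertex_vec :: "nat \<Rightarrow> (nat \<Rightarrow> real) \<Rightarrow> real vec" where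
  "vertex_vec n y = vec n (\<lambda>i. y (Suc i))"

text \<open>\<^term>\<open>q\<close> is the vector of squared entries of the positive unit Perron eigenvector.\<close>

definition spectral_entropy :: "nat \<Rightarrow> (nat \<Rightarrow> real) \<Rightarrow> real" where
  "spectral_entropy n q = (\<Sum>i = 1..n. q i * ln (1 / q i))"

end

theory Submission
  imports Defs
begin

text \<open>
  The bound is an entropy estimate. The positive eigenvector turns \<open>G\<close> into a reversible Markov
  chain: move from \<open>i\<close> to a neighbour \<open>j\<close> with probability \<open>y j / (lam * y i)\<close>. These numbers sum
  to 1 over \<open>j\<close> because \<open>y\<close> is an eigenvector, and \<open>q i = (y i)\<^sup>2\<close> is stationary because
  \<open>q i * (y j / (lam * y i)) = y i * y j / lam\<close> is symmetric in \<open>i\<close> and \<open>j\<close>.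

  Put a \<open>q\<close>-random vertex of \<open>G\<close> at the root of the tree and let the chain run independently along
  the edges away from the root. This is a random homomorphism in which the image of every tree
  vertex has law \<open>q\<close>. Its entropy is the entropy of \<open>q\<close> plus, for each edge, the conditional entropy
  of one step, which is the expected value of \<open>ln lam + ln (y i) - ln (y j)\<close>. Since \<open>i\<close> and \<open>j\<close>
  have the same law, the last two terms cancel in expectation and each of the \<open>m - 1\<close> edges
  of a tree on \<open>m\<close> vertices contributes exactly \<open>ln lam\<close>. A law on a set of \<open>N\<close> elements has
  entropy at most \<open>ln N\<close>; applied to the set of homomorphisms this is the logarithm of the claim.

  The random homomorphism is built by attaching one leaf at a time. Lemma \<open>is_tree_induct\<close> says
  that this reaches every tree, \<open>hom_law_add_leaf\<close> is the computation for one new leaf, and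
  \<open>entropy_le_ln_card\<close> is the final estimate.
\<close>

section \<open>Building trees leaf by leaf\<close>

definition add_leaf :: "'a pair_pre_digraph \<Rightarrow> 'a \<Rightarrow> 'a \<Rightarrow> 'a pair_pre_digraph" where
  "add_leaf H u v = \<lparr>pverts = insert v (pverts H), parcs = {(u, v), (v, u)} \<union> parcs H\<rparr>"

lemma add_leaf_simps [simp]:
  "pverts (add_leaf H u v) = insert v (pverts H)"
  "parcs (add_leaf H u v) = {(u, v), (v, u)} \<union> parcs H"
  by (simp_all add: add_leaf_def)

context pair_graph
begin

definition path_connected_within :: "'a set \<Rightarrow> bool" where
  "path_connected_within S \<longleftrightarrow>
     (\<forall>a\<in>S. \<forall>b\<in>S. \<exists>p. apath a p b \<and> set (pawalk_verts a p) \<subseteq> S)"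

lemma path_connected_within_insert:
  assumes conn: "path_connected_within S" and "u \<in> S" "v \<notin> S" "(v, u) \<in> parcs G"
  shows "path_connected_within (insert v S)"
proof -
  have from_v: "\<exists>p. apath v p b \<and> set (pawalk_verts v p) \<subseteq> insert v S"
    if "b \<in> insert v S" for b
  proof (cases "b = v")
    case True
    have "apath v [] v" using assms(4) in_arcsD1 by (auto simp: apath_Nil_iff)
    then show ?thesis using True by fastforce
  next
    case False
    then obtain p where p: "apath u p b" "set (pawalk_verts u p) \<subseteq> S"
      using conn \<open>u \<in> S\<close> \<open>b \<in> insert v S\<close> unfolding path_connected_within_def by blast
    then have "apath v ((v, u) # p) b"
      using assms by (auto simp: apath_Cons_iff)
    then show ?thesis using p by fastforce
  qed
  have to_v: "\<exists>p. apath b p v \<and> set (pawalk_verts b p) \<subseteq> insert v S"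
    if b: "b \<in> insert v S" for b
  proof -
    obtain p where p: "apath v p b" "set (pawalk_verts v p) \<subseteq> insert v S"
      using from_v[OF b] by blast
    then have "awalk v p b" by (simp add: apath_def)
    then have "set (pawalk_verts b (rev_path p)) = set (pawalk_verts v p)"
      using awalk_verts_rev_path[of v p b] by simp
    with p show ?thesis by (metis apath_rev_path)
  qed
  show ?thesis
    unfolding path_connected_within_def
  proof (intro ballI)
    fix a b assume a: "a \<in> insert v S" and b: "b \<in> insert v S"
    show "\<exists>p. apath a p b \<and> set (pawalk_verts a p) \<subseteq> insert v S"
    proof (cases "a = v \<or> b = v")
      case True
      then show ?thesis using from_v[OF b] to_v[OF a] by blast
    next
      case False
      then show ?thesis using a b conn unfolding path_connected_within_def by blast
    qed
  qed
qed

text \<open>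
  Two distinct neighbours \<open>u\<close>, \<open>w\<close> of \<open>v\<close> in a connected set avoiding \<open>v\<close> close a cycle
  \<open>v, u, \<dots>, w, v\<close>. It has at least three arcs, because the path from \<open>u\<close> to \<open>w\<close> is not empty.
\<close>

lemma unique_neighbour_into_path_connected_within:
  assumes acyclic: "\<not> (\<exists>p. cycle p \<and> 3 \<le> length p)"
    and conn: "path_connected_within S" and "v \<notin> S"
    and u: "u \<in> S" "(v, u) \<in> parcs G" and w: "w \<in> S" "(w, v) \<in> parcs G"
  shows "w = u"
proof (rule ccontr)
  assume "w \<noteq> u"
  obtain p where p: "apath u p w" "set (pawalk_verts u p) \<subseteq> S"
    using conn u w unfolding path_connected_within_def by blast
  have walk_p: "awalk u p w" and dist: "distinct (pawalk_verts u p)"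
    using p(1) by (auto simp: apath_def)
  have "p \<noteq> []" using walk_p \<open>w \<noteq> u\<close> by (auto simp: awalk_Nil_iff)
  have walk_wv: "awalk w [(w, v)] v"
    using w in_arcsD2 by (auto simp: awalk_simps)
  have walk_uv: "awalk u (p @ [(w, v)]) v"
    by (rule awalk_appendI[OF walk_p walk_wv])
  then have "pawalk_verts u (p @ [(w, v)]) = pawalk_verts u p @ [v]"
    using awalk_verts_append[OF walk_uv] by simp
  moreover have "v \<notin> set (pawalk_verts u p)" using p(2) \<open>v \<notin> S\<close> by blast
  ultimately have "distinct (tl (pawalk_verts v ((v, u) # p @ [(w, v)])))"
    using dist by simp
  moreover have "awalk v ((v, u) # p @ [(w, v)]) v"
    using walk_uv u(2) by (subst awalk_Cons_iff) auto
  ultimately have "cycle ((v, u) # p @ [(w, v)])"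
    unfolding cycle_def by blast
  moreover have "3 \<le> length ((v, u) # p @ [(w, v)])"
    using \<open>p \<noteq> []\<close> by (cases p) auto
  ultimately show False using acyclic by blast
qed

lemma awalk_leaves_set:
  assumes "awalk a p b" "a \<in> S" "b \<notin> S"
  shows "\<exists>u\<in>S. \<exists>v. v \<notin> S \<and> (u, v) \<in> parcs G"
  using assms
proof (induction p arbitrary: a)
  case Nil
  then show ?case by (auto simp: awalk_Nil_iff)
next
  case (Cons e p)
  then have e: "e \<in> parcs G" "a = fst e" "awalk (snd e) p b"
    by (auto simp: awalk_Cons_iff)
  show ?case
  proof (cases "snd e \<in> S")
    case True
    then show ?thesis using Cons e by blast
  next
    case False
    then show ?thesis using Cons.prems e by (metis prod.collapse)
  qed
qed

end

text \<open>
  A subtree can be grown inside \<open>T\<close>: while it misses a vertex, connectedness of \<open>T\<close> supplies an edge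
  leaving it, and the new end of that edge has only one neighbour in the subtree. Growing the
  subtree avoids having to find a leaf of \<open>T\<close> and to show that deleting it leaves a tree.
\<close>

lemma is_tree_induct [consumes 1, case_names vertex leaf]:
  assumes tree: "is_tree T"
    and vertex: "\<And>r. P \<lparr>pverts = {r}, parcs = {}\<rparr>"
    and leaf: "\<And>H u v. finite (pverts H) \<Longrightarrow> parcs H \<subseteq> pverts H \<times> pverts H \<Longrightarrow>
      u \<in> pverts H \<Longrightarrow> v \<notin> pverts H \<Longrightarrow> P H \<Longrightarrow> P (add_leaf H u v)"
  shows "P T"
proof -
  interpret T: pair_graph T using tree by (simp add: is_tree_def)
  have acyclic: "\<not> (\<exists>p. T.cycle p \<and> 3 \<le> length p)"
    using tree by (simp add: is_tree_def)
  have sc: "strongly_connected (with_proj T)"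
    using tree T.symmetric_connected_imp_strongly_connected T.sym_arcs
    by (simp add: is_tree_def)
  let ?V = "pverts T"
  let ?H = "\<lambda>S. \<lparr>pverts = S, parcs = parcs T \<inter> S \<times> S\<rparr>"
  have finV: "finite ?V" by (rule T.pair_finite_verts)
  have "?V \<noteq> {}" using sc by (auto simp: strongly_connected_def)
  then obtain r where r: "r \<in> ?V" by blast
  have card_pos: "1 \<le> card ?V"
    using r finV by (metis One_nat_def Suc_leI card_gt_0_iff empty_iff)
  have grow: "k \<le> card ?V \<longrightarrow>
      (\<exists>S\<subseteq>?V. card S = k \<and> S \<noteq> {} \<and> T.path_connected_within S \<and> P (?H S))"
    if "1 \<le> k" for k
    using that
  proof (induction k rule: nat_induct_at_least)
    case base
    have "T.apath r [] r" using r by (simp add: T.apath_Nil_iff)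
    then have "T.path_connected_within {r}"
      unfolding T.path_connected_within_def by fastforce
    moreover have "?H {r} = \<lparr>pverts = {r}, parcs = {}\<rparr>"
      using T.no_loops' by auto
    then have "P (?H {r})" using vertex by metis
    ultimately show ?case using r by (intro impI exI[of _ "{r}"]) simp
  next
    case (Suc k)
    show ?case
    proof
      assume k: "Suc k \<le> card ?V"
      then obtain S where S: "S \<subseteq> ?V" "card S = k" "S \<noteq> {}"
        "T.path_connected_within S" "P (?H S)"
        using Suc by auto
      have finS: "finite S" using S(1) finV by (rule finite_subset)
      have "S \<noteq> ?V" using S(2) k by auto
      then obtain a b where ab: "a \<in> S" "b \<in> ?V" "b \<notin> S" using S by blast
      then have "a \<rightarrow>\<^sup>*\<^bsub>with_proj T\<^esub> b"
        using sc S(1) by (auto simp: strongly_connected_def)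
      then obtain p where "T.awalk a p b" by (auto simp: T.reachable_awalk)
      then obtain u v where uv: "u \<in> S" "v \<notin> S" "(u, v) \<in> parcs T"
        using T.awalk_leaves_set ab by blast
      have vu: "(v, u) \<in> parcs T" using uv(3) by (rule T.arcs_symmetric)
      have vV: "v \<in> ?V" using vu by (rule T.in_arcsD1)
      have only_u: "w = u" if "w \<in> S" "(w, v) \<in> parcs T \<or> (v, w) \<in> parcs T" for w
        using T.unique_neighbour_into_path_connected_within[OF acyclic S(4) uv(2,1) vu]
          that T.arcs_symmetric by blast
      have "(v, v) \<notin> parcs T" using T.no_loops' by blast
      then have "parcs T \<inter> insert v S \<times> insert v S = {(u, v), (v, u)} \<union> parcs T \<inter> S \<times> S"
        using uv vu only_u by blast
      then have "?H (insert v S) = add_leaf (?H S) u v"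
        by (simp add: add_leaf_def)
      moreover have "P (add_leaf (?H S) u v)"
        using finS uv S(5) by (intro leaf) auto
      ultimately have "P (?H (insert v S))" by metis
      moreover have "T.path_connected_within (insert v S)"
        by (rule T.path_connected_within_insert[OF S(4) uv(1,2) vu])
      ultimately show "\<exists>S\<subseteq>?V. card S = Suc k \<and> S \<noteq> {} \<and>
          T.path_connected_within S \<and> P (?H S)"
        using S uv(2) vV finS by (intro exI[of _ "insert v S"]) auto
    qed
  qed
  then obtain S where S: "S \<subseteq> ?V" "card S = card ?V" "P (?H S)"
    using card_pos by blast
  have "S = ?V" using finV S(1,2) by (rule card_subset_eq)
  moreover have "?H ?V = T"
    using T.in_arcsD1 T.in_arcsD2 by (cases T) auto
  ultimately show "P T" using S(3) by metis
qed

section \<open>Homomorphisms and new leaves\<close>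

lemma finite_graph_homs:
  "finite (pverts H) \<Longrightarrow> finite (pverts G) \<Longrightarrow> finite (graph_homs H G)"
  unfolding graph_homs_def
  by (rule finite_subset[of _ "pverts H \<rightarrow>\<^sub>E pverts G"]) (auto intro: finite_PiE)

lemma graph_homs_into: "f \<in> graph_homs H G \<Longrightarrow> u \<in> pverts H \<Longrightarrow> f u \<in> pverts G"
  by (auto simp: graph_homs_def)

text \<open>
  A homomorphism from a graph with a new leaf is a homomorphism \<open>f\<close> from the old graph together with a
  neighbour of \<open>f u\<close> for the leaf.
\<close>

lemma sum_graph_homs_add_leaf:
  assumes "pair_graph G" and "finite (pverts H)" and H: "parcs H \<subseteq> pverts H \<times> pverts H"
    and u: "u \<in> pverts H" and v: "v \<notin> pverts H"
  shows "(\<Sum>g\<in>graph_homs (add_leaf H u v) G. F (restrict g (pverts H)) (g v)) =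
    (\<Sum>f\<in>graph_homs H G. \<Sum>j | j \<in> pverts G \<and> (f u, j) \<in> parcs G. F f j)"
proof -
  interpret G: pair_graph G by fact
  have fin: "finite (graph_homs H G)"
    using assms(2) G.pair_finite_verts by (rule finite_graph_homs)
  have ext: "f \<in> extensional (pverts H)" if "f \<in> graph_homs H G" for f
    using that by (auto simp: graph_homs_def PiE_iff)
  have "(\<Sum>f\<in>graph_homs H G. \<Sum>j | j \<in> pverts G \<and> (f u, j) \<in> parcs G. F f j) =
      (\<Sum>(f, j)\<in>(SIGMA f:graph_homs H G. {j. j \<in> pverts G \<and> (f u, j) \<in> parcs G}). F f j)"
    using fin G.pair_finite_verts by (intro sum.Sigma) auto
  also have "\<dots> = (\<Sum>g\<in>graph_homs (add_leaf H u v) G. F (restrict g (pverts H)) (g v))"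
  proof (rule sum.reindex_bij_witness[where i = "\<lambda>g. (restrict g (pverts H), g v)"
        and j = "\<lambda>(f, j). f(v := j)"], goal_cases)
    case (1 a)
    then obtain f j where a: "a = (f, j)" "f \<in> graph_homs H G" by auto
    then show ?case using v ext[OF a(2)] by (auto simp: restrict_def extensional_def)
  next
    case (2 a)
    then obtain f j where a: "a = (f, j)" "f \<in> graph_homs H G" "j \<in> pverts G"
      "(f u, j) \<in> parcs G" by auto
    have into: "(f(v := j)) x \<in> pverts G" if "x \<in> insert v (pverts H)" for x
      using that a graph_homs_into[OF a(2)] by auto
    have outside: "(f(v := j)) x = undefined" if "x \<notin> insert v (pverts H)" for x
      using that ext[OF a(2)] by (auto simp: extensional_def)
    have "f(v := j) \<in> pverts (add_leaf H u v) \<rightarrow>\<^sub>E pverts G"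
      by (rule PiE_I) (use into outside in simp_all)
    moreover have "((f(v := j)) x, (f(v := j)) z) \<in> parcs G"
      if xz: "(x, z) \<in> parcs (add_leaf H u v)" for x z
    proof -
      have ju: "(j, f u) \<in> parcs G" using a(4) by (rule G.arcs_symmetric)
      consider "(x, z) = (u, v)" | "(x, z) = (v, u)" | "(x, z) \<in> parcs H"
        using xz by auto
      then show ?thesis
      proof cases
        case 3
        then have "x \<noteq> v" "z \<noteq> v" using H v by auto
        then show ?thesis using 3 a(2) by (simp add: graph_homs_def)
      qed (use a(4) ju u v in auto)
    qed
    ultimately show ?case unfolding graph_homs_def a(1) prod.case by blast
  next
    case (3 g)
    then have "g \<in> extensional (insert v (pverts H))" by (auto simp: graph_homs_def PiE_iff)
    then show ?case by (auto simp: restrict_def extensional_def)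
  next
    case (4 g)
    then have "restrict g (pverts H) \<in> graph_homs H G"
      using H by (auto simp: graph_homs_def Pi_iff PiE_iff)
    moreover have "g v \<in> pverts G" "(g u, g v) \<in> parcs G"
      using 4 by (auto simp: graph_homs_def)
    ultimately show ?case using u by auto
  next
    case (5 a)
    then obtain f j where a: "a = (f, j)" "f \<in> graph_homs H G" by auto
    have "restrict (f(v := j)) (pverts H) = f"
      using v ext[OF a(2)] by (auto simp: restrict_def extensional_def)
    then show ?case using a(1) by simp
  qed
  finally show ?thesis by simp
qed

section \<open>Entropy and the random homomorphism\<close>

text \<open>Apply \<open>ln x \<le> x - 1\<close> to the ratio \<open>x = 1 / (N * p a)\<close> of the uniform law to \<open>p\<close>, where \<open>N\<close> is
  the number of points, and average.\<close>

lemma entropy_le_ln_card: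
  fixes p :: "'a \<Rightarrow> real"
  assumes "finite A" and pos: "\<And>a. a \<in> A \<Longrightarrow> 0 < p a" and total: "sum p A = 1"
  shows "- (\<Sum>a\<in>A. p a * ln (p a)) \<le> ln (real (card A))"
proof -
  let ?N = "real (card A)"
  have "A \<noteq> {}" using total by auto
  then have N: "0 < ?N" using assms(1) by (simp add: card_gt_0_iff)
  have "- (p a * ln (p a)) - p a * ln ?N \<le> 1 / ?N - p a" if "a \<in> A" for a
  proof -
    have pa: "0 < p a" using pos that .
    have "ln (1 / (?N * p a)) \<le> 1 / (?N * p a) - 1"
      using N pa by (intro ln_le_minus_one) simp
    then have "p a * ln (1 / (?N * p a)) \<le> p a * (1 / (?N * p a) - 1)"
      using pa by (intro mult_left_mono) auto
    also have "\<dots> = 1 / ?N - p a" using pa N by (simp add: field_simps)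
    finally show ?thesis using N pa by (simp add: ln_div ln_mult algebra_simps)
  qed
  then have "(\<Sum>a\<in>A. - (p a * ln (p a)) - p a * ln ?N) \<le> (\<Sum>a\<in>A. 1 / ?N - p a)"
    by (rule sum_mono)
  moreover have "(\<Sum>a\<in>A. - (p a * ln (p a)) - p a * ln ?N) =
      - (\<Sum>a\<in>A. p a * ln (p a)) - ln ?N"
    using total by (simp add: sum_subtractf sum_negf flip: sum_distrib_right)
  moreover have "(\<Sum>a\<in>A. 1 / ?N - p a) = 0"
    using total N by (simp add: sum_subtractf)
  ultimately show ?thesis by simp
qed

locale positive_unit_eigenvector =
  fixes G :: "'b pair_pre_digraph" and lam :: real and y :: "'b \<Rightarrow> real"
  assumes pair_graph: "pair_graph G"
    and y_pos: "i \<in> pverts G \<Longrightarrow> 0 < y i"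
    and eigen: "i \<in> pverts G \<Longrightarrow> (\<Sum>j | j \<in> pverts G \<and> (i, j) \<in> parcs G. y j) = lam * y i"
    and unit: "(\<Sum>i\<in>pverts G. (y i)\<^sup>2) = 1"
begin

sublocale G: pair_graph G by (rule pair_graph)

abbreviation nbrs :: "'b \<Rightarrow> 'b set" where
  "nbrs i \<equiv> {j. j \<in> pverts G \<and> (i, j) \<in> parcs G}"

definition step_prob :: "'b \<Rightarrow> 'b \<Rightarrow> real" where
  "step_prob i j = y j / (lam * y i)"

definition vertex_entropy :: real where
  "vertex_entropy = - (\<Sum>i\<in>pverts G. (y i)\<^sup>2 * ln ((y i)\<^sup>2))"

lemma lam_nonneg: "0 \<le> lam"
proof -
  have "pverts G \<noteq> {}" using unit by auto
  then obtain i where i: "i \<in> pverts G" by blast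
  have "0 \<le> (\<Sum>j\<in>nbrs i. y j)" by (intro sum_nonneg) (auto intro: less_imp_le y_pos)
  then have "0 \<le> lam * y i" using eigen[OF i] by simp
  then show ?thesis using y_pos[OF i] by (simp add: zero_le_mult_iff)
qed

lemma step_prob_total:
  assumes "0 < lam" "i \<in> pverts G"
  shows "(\<Sum>j\<in>nbrs i. step_prob i j) = 1"
  using eigen[OF assms(2)] y_pos[OF assms(2)] assms(1)
  by (simp add: step_prob_def flip: sum_divide_distrib)

lemma step_prob_stationary:
  assumes "0 < lam"
  shows "(\<Sum>i\<in>pverts G. (y i)\<^sup>2 * (\<Sum>j\<in>nbrs i. step_prob i j * \<phi> j)) =
    (\<Sum>j\<in>pverts G. (y j)\<^sup>2 * \<phi> j)"
proof -
  have "(\<Sum>i\<in>pverts G. (y i)\<^sup>2 * (\<Sum>j\<in>nbrs i. step_prob i j * \<phi> j)) =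
      (\<Sum>i\<in>pverts G. \<Sum>j\<in>nbrs i. y i * (y j * \<phi> j / lam))"
    unfolding sum_distrib_left
  proof (intro sum.cong refl)
    fix i j assume "i \<in> pverts G"
    then show "(y i)\<^sup>2 * (step_prob i j * \<phi> j) = y i * (y j * \<phi> j / lam)"
      using assms y_pos[of i] by (simp add: step_prob_def field_simps power2_eq_square)
  qed
  also have "\<dots> = (\<Sum>j\<in>pverts G. \<Sum>i | i \<in> pverts G \<and> (i, j) \<in> parcs G. y i * (y j * \<phi> j / lam))"
    using G.pair_finite_verts by (intro sum.swap_restrict) auto
  also have "\<dots> = (\<Sum>j\<in>pverts G. (\<Sum>i\<in>nbrs j. y i) * (y j * \<phi> j / lam))"
    unfolding sum_distrib_right
    by (intro sum.cong refl) (auto intro: G.arcs_symmetric)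
  also have "\<dots> = (\<Sum>j\<in>pverts G. (y j)\<^sup>2 * \<phi> j)"
    using assms eigen by (intro sum.cong refl) (simp add: field_simps power2_eq_square)
  finally show ?thesis .
qed

text \<open>
  The invariant kept while a tree \<open>H\<close> is built: \<open>p\<close> is a positive weight on the homomorphisms, every
  vertex of \<open>H\<close> has an image with law \<open>(y i)\<^sup>2\<close>, and \<open>p\<close> has the required entropy. The marginals are
  expressed through test functions \<open>\<phi>\<close>, so that \<open>\<phi> = 1\<close> gives the total mass.
\<close>

definition hom_law :: "'a pair_pre_digraph \<Rightarrow> (('a \<Rightarrow> 'b) \<Rightarrow> real) \<Rightarrow> bool" where
  "hom_law H p \<longleftrightarrow>
     (\<forall>f\<in>graph_homs H G. 0 < p f) \<and>
     (\<forall>u\<in>pverts H. \<forall>\<phi>. (\<Sum>f\<in>graph_homs H G. p f * \<phi> (f u)) = (\<Sum>i\<in>pverts G. (y i)\<^sup>2 * \<phi> i)) \<and>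
     - (\<Sum>f\<in>graph_homs H G. p f * ln (p f)) = vertex_entropy + (real (card (pverts H)) - 1) * ln lam"

lemma hom_lawD:
  assumes "hom_law H p"
  shows "f \<in> graph_homs H G \<Longrightarrow> 0 < p f"
    and "u \<in> pverts H \<Longrightarrow> (\<Sum>f\<in>graph_homs H G. p f * \<phi> (f u)) = (\<Sum>i\<in>pverts G. (y i)\<^sup>2 * \<phi> i)"
    and "- (\<Sum>f\<in>graph_homs H G. p f * ln (p f)) =
      vertex_entropy + (real (card (pverts H)) - 1) * ln lam"
  using assms unfolding hom_law_def by blast+

lemma hom_law_vertex: "hom_law \<lparr>pverts = {r}, parcs = {}\<rparr> (\<lambda>f. (y (f r))\<^sup>2)"
proof -
  let ?H = "\<lparr>pverts = {r}, parcs = {}\<rparr>"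
  have reindex: "(\<Sum>f\<in>graph_homs ?H G. F (f r)) = sum F (pverts G)" for F :: "'b \<Rightarrow> real"
    by (rule sum.reindex_bij_witness[where j = "\<lambda>f. f r" and i = "\<lambda>i. \<lambda>x\<in>{r}. i"])
      (auto simp: graph_homs_def PiE_iff extensional_def restrict_def)
  have "0 < (y (f r))\<^sup>2" if "f \<in> graph_homs ?H G" for f
    using y_pos[OF graph_homs_into[OF that, of r]] by simp
  then show ?thesis
    using reindex[of "\<lambda>i. (y i)\<^sup>2 * \<phi> i" for \<phi>] reindex[of "\<lambda>i. (y i)\<^sup>2 * ln ((y i)\<^sup>2)"]
    by (simp add: hom_law_def vertex_entropy_def)
qed

text \<open>
  The leaf takes one step of the chain from the image of its neighbour \<open>u\<close>. Old marginals persist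
  because step probabilities sum to 1, and the leaf has the same marginal because it is stationary.
  The new term \<open>- ln (step_prob i j) = ln lam + ln (y i) - ln (y j)\<close> of the entropy has mean
  \<open>ln lam\<close>, since \<open>i\<close> and \<open>j\<close> are equally distributed.
\<close>

lemma hom_law_add_leaf:
  assumes lam: "0 < lam"
    and H: "finite (pverts H)" "parcs H \<subseteq> pverts H \<times> pverts H"
    and u: "u \<in> pverts H" and v: "v \<notin> pverts H"
    and p: "hom_law H p"
  shows "hom_law (add_leaf H u v) (\<lambda>g. p (restrict g (pverts H)) * step_prob (g u) (g v))"
    (is "hom_law ?H' ?p'")
proof -
  let ?homs = "graph_homs H G"
  note sum_homs = sum_graph_homs_add_leaf[OF pair_graph H u v]
  have p_pos: "0 < p f" if "f \<in> ?homs" for f using p that by (rule hom_lawD)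
  have marginal: "(\<Sum>f\<in>?homs. p f * \<phi> (f w)) = (\<Sum>i\<in>pverts G. (y i)\<^sup>2 * \<phi> i)"
    if "w \<in> pverts H" for w \<phi>
    using p that by (rule hom_lawD)
  have step_total: "(\<Sum>j\<in>nbrs (f u). step_prob (f u) j) = 1" if "f \<in> ?homs" for f
    using lam graph_homs_into[OF that u] by (rule step_prob_total)
  have pos: "0 < ?p' g" if g: "g \<in> graph_homs ?H' G" for g
  proof -
    have "restrict g (pverts H) \<in> ?homs"
      using g H by (auto simp: graph_homs_def Pi_iff PiE_iff)
    moreover have "0 < y (g u)" "0 < y (g v)"
      using graph_homs_into[OF g] u by (auto intro!: y_pos)
    ultimately show ?thesis using lam p_pos by (simp add: step_prob_def)
  qed
  have old_marginal: "(\<Sum>g\<in>graph_homs ?H' G. ?p' g * \<phi> (g w)) = (\<Sum>i\<in>pverts G. (y i)\<^sup>2 * \<phi> i)"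
    if w: "w \<in> pverts H" for w \<phi>
  proof -
    have "(\<Sum>g\<in>graph_homs ?H' G. ?p' g * \<phi> (g w)) =
        (\<Sum>f\<in>?homs. \<Sum>j\<in>nbrs (f u). p f * step_prob (f u) j * \<phi> (f w))"
      using sum_homs[of "\<lambda>f j. p f * step_prob (f u) j * \<phi> (f w)"] u w by simp
    also have "\<dots> = (\<Sum>f\<in>?homs. p f * \<phi> (f w))"
    proof (intro sum.cong refl)
      fix f assume f: "f \<in> ?homs"
      have "(\<Sum>j\<in>nbrs (f u). p f * step_prob (f u) j * \<phi> (f w)) =
          p f * \<phi> (f w) * (\<Sum>j\<in>nbrs (f u). step_prob (f u) j)"
        unfolding sum_distrib_left by (intro sum.cong) auto
      then show "(\<Sum>j\<in>nbrs (f u). p f * step_prob (f u) j * \<phi> (f w)) = p f * \<phi> (f w)"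
        using step_total[OF f] by simp
    qed
    finally show ?thesis using marginal[OF w] by simp
  qed
  have leaf_mean: "(\<Sum>f\<in>?homs. p f * (\<Sum>j\<in>nbrs (f u). step_prob (f u) j * \<phi> j)) =
      (\<Sum>i\<in>pverts G. (y i)\<^sup>2 * \<phi> i)" for \<phi>
    using marginal[OF u, of "\<lambda>i. \<Sum>j\<in>nbrs i. step_prob i j * \<phi> j"]
      step_prob_stationary[OF lam, of \<phi>] by simp
  have leaf_marginal: "(\<Sum>g\<in>graph_homs ?H' G. ?p' g * \<phi> (g v)) = (\<Sum>i\<in>pverts G. (y i)\<^sup>2 * \<phi> i)"
    for \<phi>
    using sum_homs[of "\<lambda>f j. p f * step_prob (f u) j * \<phi> j"] u leaf_mean[of \<phi>]
    by (simp add: sum_distrib_left mult.assoc)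
  have entropy: "(\<Sum>g\<in>graph_homs ?H' G. ?p' g * ln (?p' g)) =
      (\<Sum>f\<in>?homs. p f * ln (p f)) - ln lam"
  proof -
    let ?L = "\<lambda>f j. p f * step_prob (f u) j * ln (p f * step_prob (f u) j)"
    have "(\<Sum>g\<in>graph_homs ?H' G. ?p' g * ln (?p' g)) = (\<Sum>f\<in>?homs. \<Sum>j\<in>nbrs (f u). ?L f j)"
      using sum_homs[of ?L] u by simp
    also have "\<dots> = (\<Sum>f\<in>?homs. p f * ln (p f) - p f * ln lam - p f * ln (y (f u)) +
        p f * (\<Sum>j\<in>nbrs (f u). step_prob (f u) j * ln (y j)))"
    proof (intro sum.cong refl)
      fix f assume f: "f \<in> ?homs"
      have yu: "0 < y (f u)" using graph_homs_into[OF f u] by (rule y_pos)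
      have "?L f j = p f * (ln (p f) - ln lam - ln (y (f u))) * step_prob (f u) j +
          p f * (step_prob (f u) j * ln (y j))" if "j \<in> nbrs (f u)" for j
      proof -
        have "0 < y j" using that by (auto intro: y_pos)
        then have "ln (p f * step_prob (f u) j) = ln (p f) - ln lam - ln (y (f u)) + ln (y j)"
          using lam yu p_pos[OF f] by (simp add: step_prob_def ln_mult ln_div)
        then show ?thesis by (simp only:) (simp add: algebra_simps)
      qed
      then have "(\<Sum>j\<in>nbrs (f u). ?L f j) =
          p f * (ln (p f) - ln lam - ln (y (f u))) * (\<Sum>j\<in>nbrs (f u). step_prob (f u) j) +
          p f * (\<Sum>j\<in>nbrs (f u). step_prob (f u) j * ln (y j))"
        by (simp add: sum.distrib sum_distrib_left)
      then show "(\<Sum>j\<in>nbrs (f u). ?L f j) =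
          p f * ln (p f) - p f * ln lam - p f * ln (y (f u)) +
          p f * (\<Sum>j\<in>nbrs (f u). step_prob (f u) j * ln (y j))"
        using step_total[OF f] by (simp add: algebra_simps)
    qed
    also have "\<dots> = (\<Sum>f\<in>?homs. p f * ln (p f)) - (\<Sum>f\<in>?homs. p f * ln lam)"
      using marginal[OF u, of "\<lambda>i. ln (y i)"] leaf_mean[of "\<lambda>i. ln (y i)"]
      by (simp add: sum.distrib sum_subtractf)
    also have "(\<Sum>f\<in>?homs. p f * ln lam) = ln lam"
      using marginal[OF u, of "\<lambda>_. ln lam"] unit by (simp flip: sum_distrib_right)
    finally show ?thesis .
  qed
  have "- (\<Sum>f\<in>?homs. p f * ln (p f)) = vertex_entropy + (real (card (pverts H)) - 1) * ln lam"
    using p by (rule hom_lawD)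
  then have "- (\<Sum>g\<in>graph_homs ?H' G. ?p' g * ln (?p' g)) =
      vertex_entropy + (real (card (pverts ?H')) - 1) * ln lam"
    unfolding entropy using H(1) v by (simp add: algebra_simps)
  then show ?thesis
    using pos old_marginal leaf_marginal by (auto simp: hom_law_def)
qed

text \<open>
  The chain needs \<open>lam > 0\<close>. If \<open>G\<close> has no edge then \<open>lam = 0\<close>, and a single vertex is the only
  tree for which the bound still says something; its law involves no step of the chain.
\<close>

lemma hom_law_exists:
  assumes "is_tree T" and "0 < lam \<or> card (pverts T) = 1"
  shows "\<exists>p. hom_law T p"
  using assms
proof (induction rule: is_tree_induct)
  case (vertex r)
  show ?case by (intro exI) (rule hom_law_vertex)
next
  case (leaf H u v)
  have "card (pverts (add_leaf H u v)) \<noteq> 1"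
    using leaf.hyps by auto
  then have lam: "0 < lam" using leaf.prems by blast
  then obtain p where p: "hom_law H p" using leaf.IH by blast
  show ?case by (intro exI) (rule hom_law_add_leaf[OF lam leaf.hyps p])
qed

theorem hom_count_tree_ge:
  assumes tree: "is_tree T"
  shows "exp vertex_entropy * lam ^ (card (pverts T) - 1) \<le> real (hom_count T G)"
proof -
  interpret T: pair_graph T using tree by (simp add: is_tree_def)
  have "pverts T \<noteq> {}"
    using tree by (simp add: is_tree_def connected_conv)
  then have card_pos: "0 < card (pverts T)"
    using T.pair_finite_verts by (simp add: card_gt_0_iff)
  show ?thesis
  proof (cases "0 < lam \<or> card (pverts T) = 1")
    case False
    then have "lam = 0" "0 < card (pverts T) - 1" using lam_nonneg card_pos by auto
    then show ?thesis by (simp add: power_0_left)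
  next
    case True
    then obtain p where p: "hom_law T p" using hom_law_exists[OF tree] by blast
    let ?homs = "graph_homs T G"
    have fin: "finite ?homs"
      using T.pair_finite_verts G.pair_finite_verts by (rule finite_graph_homs)
    obtain r where "r \<in> pverts T" using \<open>pverts T \<noteq> {}\<close> by blast
    then have total: "sum p ?homs = 1"
      using hom_lawD(2)[OF p, of r "\<lambda>_. 1"] unit by simp
    have "vertex_entropy + (real (card (pverts T)) - 1) * ln lam =
        - (\<Sum>f\<in>?homs. p f * ln (p f))"
      using hom_lawD(3)[OF p] by simp
    also have "\<dots> \<le> ln (real (card ?homs))"
      using fin hom_lawD(1)[OF p] total by (rule entropy_le_ln_card)
    finally have le: "vertex_entropy + real (card (pverts T) - 1) * ln lam \<le> ln (real (card ?homs))"
      using card_pos by (simp add: of_nat_diff)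
    have "?homs \<noteq> {}" using total by auto
    then have "0 < card ?homs" using fin by (simp add: card_gt_0_iff)
    then have "exp (vertex_entropy + real (card (pverts T) - 1) * ln lam) \<le> real (card ?homs)"
      using le by (simp add: ln_ge_iff)
    moreover have "exp (real (card (pverts T) - 1) * ln lam) = lam ^ (card (pverts T) - 1)"
      using True by (auto simp: exp_of_nat_mult)
    ultimately show ?thesis by (simp add: exp_add hom_count_def)
  qed
qed

end

section \<open>The spectral entropy bound\<close>

lemma eigenvector_adjacency_matrix_row:
  assumes ev: "eigenvector (adjacency_matrix n G) (vertex_vec n y) lam" and i: "i \<in> {1..n}"
  shows "(\<Sum>j | j \<in> {1..n} \<and> (i, j) \<in> parcs G. y j) = lam * y i"
proof -
  obtain k where k: "i = Suc k" "k < n" using i by (cases i) auto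
  have "(\<Sum>j | j \<in> {1..n} \<and> (i, j) \<in> parcs G. y j) =
      (\<Sum>j\<in>{1..n}. if (i, j) \<in> parcs G then y j else 0)"
    by (rule sum.inter_filter) simp
  also have "\<dots> = (\<Sum>j\<in>{0..<n}. (if (i, Suc j) \<in> parcs G then y (Suc j) else 0))"
    by (rule sum.reindex_bij_witness[where i = Suc and j = "\<lambda>j. j - 1"]) auto
  also have "\<dots> = (adjacency_matrix n G *\<^sub>v vertex_vec n y) $ k"
  proof -
    have "(adjacency_matrix n G *\<^sub>v vertex_vec n y) $ k =
        (\<Sum>j\<in>{0..<n}. row (adjacency_matrix n G) k $ j * vertex_vec n y $ j)"
      using k by (simp add: adjacency_matrix_def vertex_vec_def scalar_prod_def)
    also have "\<dots> = (\<Sum>j\<in>{0..<n}. if (i, Suc j) \<in> parcs G then y (Suc j) else 0)"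
      using k by (intro sum.cong refl) (simp add: adjacency_matrix_def vertex_vec_def)
    finally show ?thesis by (rule sym)
  qed
  also have "\<dots> = (lam \<cdot>\<^sub>v vertex_vec n y) $ k"
    using ev by (simp add: eigenvector_def)
  also have "\<dots> = lam * y i" using k by (simp add: vertex_vec_def)
  finally show ?thesis .
qed

theorem theorem3p3:
  fixes n m :: nat
    and G :: "nat pair_pre_digraph"
    and T :: "'t pair_pre_digraph"
    and lam :: real
    and y q :: "nat \<Rightarrow> real"
  assumes "pair_graph G"
    and "pverts G = {1..n}"
    and "Digraph_Component.connected (with_proj G)"
    and "lam = Max (spectrum (adjacency_matrix n G))"
    and "eigenvector (adjacency_matrix n G) (vertex_vec n y) lam"
    and "\<forall>i\<in>{1..n}. 0 < y i"
    and "L2_set y {1..n} = 1"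
    and "\<forall>i\<in>{1..n}. q i = (y i)\<^sup>2"
    and "is_tree T"
    and "card (pverts T) = m"
  shows "real (hom_count T G) \<ge> exp (spectral_entropy n q) * lam ^ (m - 1)"
proof -
  have "(\<Sum>i\<in>{1..n}. (y i)\<^sup>2) = 1"
    using assms(7) by (simp add: L2_set_def)
  then interpret positive_unit_eigenvector G lam y
    using assms(1,2,6) eigenvector_adjacency_matrix_row[OF assms(5)]
    by (intro positive_unit_eigenvector.intro) auto
  have "spectral_entropy n q = vertex_entropy"
    unfolding spectral_entropy_def vertex_entropy_def assms(2) sum_negf[symmetric]
  proof (intro sum.cong refl)
    fix i assume i: "i \<in> {1..n}"
    then have "q i = (y i)\<^sup>2" "0 < y i" using assms(6,8) by blast+
    then show "q i * ln (1 / q i) = - ((y i)\<^sup>2 * ln ((y i)\<^sup>2))"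
      by (simp add: ln_div)
  qed
  then show ?thesis
    using hom_count_tree_ge[OF assms(9)] assms(10) by simp
qed

end
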